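(* Let $(X,d)$ be a compact ultrametric space. Then $(X,d)$ is a $\mathbf{US}$-space if and only if $(X,d)$ contains no four-point subspace which is weakly similar to $(X_4,d_4)$ or to $(Y_4,\rho_4)$.
   Context: Let $\mathbb{R}^+=[0,\infty)$. A semimetric on a nonempty set $X$ is a symmetric function $d\colon X\times X\to\mathbb{R}^+$ with $d(x,y)=0$ iff $x=y$; it is an ultrametric if $d(x,y)\le\max\{d(x,z),d(z,y)\}$ for all $x,y,z\in X$. All (ultrametric) spaces are nonempty. A tree $T$ (finite or infinite, connected simple graph without cycles, with nonempty vertex set) is a star graph with center $c\in V(T)$ if $c$ is adjacent to every other vertex and no two vertices different from $c$ are adjacent. A labeled tree $T(l)$ is a tree $T$ with a labeling $l\colon V(T)\to\mathbb{R}^+$. For a labeled tree define $d_l(u,u)=0$ and, for $u\neq v$, $d_l(u,v)=\max_{w\in V(P)} l(w)$, where $P$ is the path joining $u$ and $v$ in $T$ (endpoints included). An ultrametric space $(X,d)$ is generated by $T(l)$ if $X=V(T)$ and $d=d_l$. An ultrametric space is a $\mathbf{US}$-space if it is generated by some labeled star graph. For a semimetric space put $D(X)=\{d(x,y):x,y\in X\}$. Semimetric spaces $(X,d)$ and $(Y,\rho)$ are weakly similar if there are a bijection $\Phi\colon X\to Y$ and a strictly increasing bijection $f\colon D(Y)\to D(X)$ such that $d(x,y)=f(\rho(\Phi(x),\Phi(y)))$ for all $x,y\in X$. $(X_4,d_4)$ is the four-point ultrametric space $\{a,b,c,e\}$ with $d_4(a,c)=1$, $d_4(b,e)=2$, and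 all other distances between distinct points equal to $3$. $(Y_4,\rho_4)$ is the four-point ultrametric space $\{a,b,c,e\}$ with $\rho_4(a,c)=2$, $\rho_4(b,e)=2$, and all other distances between distinct points equal to $3$. *)

theory Defs
  imports "HOL-Analysis.Analysis"
begin

section \<open>Semimetric and ultrametric spaces on a carrier set\<close>

text \<open>
  A space is a carrier set \<open>X\<close> with a function \<open>d :: 'a \<Rightarrow> 'a \<Rightarrow> real\<close> of which only the values
  on \<open>X \<times> X\<close> matter, so a subspace is given by a subset of \<open>X\<close> with the same \<open>d\<close>.
\<close>

definition semimetric_on :: "'a set \<Rightarrow> ('a \<Rightarrow> 'a \<Rightarrow> real) \<Rightarrow> bool" where
  "semimetric_on X d \<longleftrightarrow> X \<noteq> {} \<and>
     (\<forall>x\<in>X. \<forall>y\<in>X. 0 \<le> d x y \<and> d x y = d y x \<and> (d x y = 0 \<longleftrightarrow> x = y))"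

definition ultrametric_on :: "'a set \<Rightarrow> ('a \<Rightarrow> 'a \<Rightarrow> real) \<Rightarrow> bool" where
  "ultrametric_on X d \<longleftrightarrow> semimetric_on X d \<and>
     (\<forall>x\<in>X. \<forall>y\<in>X. \<forall>z\<in>X. d x y \<le> max (d x z) (d z y))"

text \<open>
  The library locale \<open>Metric_space\<close> asks for symmetry and nonnegativity on the whole type;
  the extension by zero outside the carrier satisfies this without changing the space.
\<close>

definition zero_ext :: "'a set \<Rightarrow> ('a \<Rightarrow> 'a \<Rightarrow> real) \<Rightarrow> 'a \<Rightarrow> 'a \<Rightarrow> real" where
  "zero_ext X d x y = (if x \<in> X \<and> y \<in> X then d x y else 0)"

lemma Metric_space_zero_ext:
  assumes "ultrametric_on X d"
  shows "Metric_space X (zero_ext X d)"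
proof
  fix x y z assume *: "x \<in> X" "y \<in> X" "z \<in> X"
  then have "d x z \<le> max (d x y) (d y z)" "0 \<le> d x y" "0 \<le> d y z"
    using assms by (auto simp: ultrametric_on_def semimetric_on_def)
  then show "zero_ext X d x z \<le> zero_ext X d x y + zero_ext X d y z"
    using * by (auto simp: zero_ext_def)
qed (use assms in \<open>auto simp: zero_ext_def ultrametric_on_def semimetric_on_def\<close>)

definition compact_on :: "'a set \<Rightarrow> ('a \<Rightarrow> 'a \<Rightarrow> real) \<Rightarrow> bool" where
  "compact_on X d \<longleftrightarrow> compact_space (Metric_space.mtopology X (zero_ext X d))"

lemma openin_mtopology_zero_ext:
  assumes "ultrametric_on X d"
  shows "openin (Metric_space.mtopology X (zero_ext X d)) U \<longleftrightarrow>
    U \<subseteq> X \<and> (\<forall>x\<in>U. \<exists>r>0. \<forall>y\<in>X. d x y < r \<longrightarrow> y \<in> U)"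
proof -
  interpret Metric_space X "zero_ext X d"
    by (rule Metric_space_zero_ext[OF assms])
  have ball: "mball x r \<subseteq> U \<longleftrightarrow> (\<forall>y\<in>X. d x y < r \<longrightarrow> y \<in> U)" if "x \<in> X" for x r
    using that by (auto simp: in_mball zero_ext_def)
  show ?thesis
    unfolding openin_mtopology using ball by blast
qed

lemma compact_on_iff_mtopology:
  assumes "Metric_space X d" "ultrametric_on X d"
  shows "compact_on X d \<longleftrightarrow> compact_space (Metric_space.mtopology X d)"
proof -
  interpret Metric_space X d by fact
  have ball: "mball x r \<subseteq> U \<longleftrightarrow> (\<forall>y\<in>X. d x y < r \<longrightarrow> y \<in> U)" if "x \<in> X" for x r U
    using that by auto
  have "openin mtopology U \<longleftrightarrow>
      U \<subseteq> X \<and> (\<forall>x\<in>U. \<exists>r>0. \<forall>y\<in>X. d x y < r \<longrightarrow> y \<in> U)" for U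
    unfolding openin_mtopology using ball by blast
  then have "mtopology = Metric_space.mtopology X (zero_ext X d)"
    by (simp add: topology_eq openin_mtopology_zero_ext[OF assms(2)])
  then show ?thesis by (simp add: compact_on_def)
qed

definition dist_set :: "'a set \<Rightarrow> ('a \<Rightarrow> 'a \<Rightarrow> real) \<Rightarrow> real set" where
  "dist_set X d = {d x y | x y. x \<in> X \<and> y \<in> X}"

definition weakly_similar ::
  "'a set \<Rightarrow> ('a \<Rightarrow> 'a \<Rightarrow> real) \<Rightarrow> 'b set \<Rightarrow> ('b \<Rightarrow> 'b \<Rightarrow> real) \<Rightarrow> bool" where
  "weakly_similar X d Y \<rho> \<longleftrightarrow>
     (\<exists>\<Phi> f. bij_betw \<Phi> X Y \<and>
            bij_betw f (dist_set Y \<rho>) (dist_set X d) \<and>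
            strict_mono_on (dist_set Y \<rho>) f \<and>
            (\<forall>x\<in>X. \<forall>y\<in>X. d x y = f (\<rho> (\<Phi> x) (\<Phi> y))))"


section \<open>Trees, star graphs and the spaces they generate\<close>

text \<open>
  Simple graphs, possibly infinite, as a vertex set \<open>V\<close> together with a set \<open>E\<close> of
  two-element subsets of \<open>V\<close>. A path is given by the list of its vertices.
\<close>

definition simple_graph :: "'a set \<Rightarrow> 'a set set \<Rightarrow> bool" where
  "simple_graph V E \<longleftrightarrow> (\<forall>e\<in>E. \<exists>u\<in>V. \<exists>v\<in>V. u \<noteq> v \<and> e = {u, v})"

definition path_joining :: "'a set \<Rightarrow> 'a set set \<Rightarrow> 'a \<Rightarrow> 'a \<Rightarrow> 'a list \<Rightarrow> bool" where
  "path_joining V E u v p \<longleftrightarrow>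
     p \<noteq> [] \<and> hd p = u \<and> last p = v \<and> set p \<subseteq> V \<and> distinct p \<and>
     successively (\<lambda>x y. {x, y} \<in> E) p"

definition connected_graph :: "'a set \<Rightarrow> 'a set set \<Rightarrow> bool" where
  "connected_graph V E \<longleftrightarrow> (\<forall>u\<in>V. \<forall>v\<in>V. \<exists>p. path_joining V E u v p)"

definition graph_cycle :: "'a set \<Rightarrow> 'a set set \<Rightarrow> 'a list \<Rightarrow> bool" where
  "graph_cycle V E p \<longleftrightarrow>
     length p \<ge> 3 \<and> path_joining V E (hd p) (last p) p \<and> {last p, hd p} \<in> E"

definition tree :: "'a set \<Rightarrow> 'a set set \<Rightarrow> bool" where
  "tree V E \<longleftrightarrow>
     simple_graph V E \<and> V \<noteq> {} \<and> connected_graph V E \<and> (\<nexists>p. graph_cycle V E p)"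

definition star_graph :: "'a set \<Rightarrow> 'a set set \<Rightarrow> 'a \<Rightarrow> bool" where
  "star_graph V E c \<longleftrightarrow> tree V E \<and> c \<in> V \<and>
     (\<forall>v\<in>V - {c}. {c, v} \<in> E) \<and>
     (\<forall>u\<in>V - {c}. \<forall>v\<in>V - {c}. {u, v} \<notin> E)"

definition labeled_tree :: "'a set \<Rightarrow> 'a set set \<Rightarrow> ('a \<Rightarrow> real) \<Rightarrow> bool" where
  "labeled_tree V E l \<longleftrightarrow> tree V E \<and> (\<forall>v\<in>V. 0 \<le> l v)"

text \<open>Meaningful when the joining path is unique, which is the case in a tree.\<close>

definition label_dist :: "'a set \<Rightarrow> 'a set set \<Rightarrow> ('a \<Rightarrow> real) \<Rightarrow> 'a \<Rightarrow> 'a \<Rightarrow> real" where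
  "label_dist V E l u v =
     (if u = v then 0 else Max (l ` set (THE p. path_joining V E u v p)))"

definition generated_by ::
  "'a set \<Rightarrow> ('a \<Rightarrow> 'a \<Rightarrow> real) \<Rightarrow> 'a set \<Rightarrow> 'a set set \<Rightarrow> ('a \<Rightarrow> real) \<Rightarrow> bool" where
  "generated_by X d V E l \<longleftrightarrow> labeled_tree V E l \<and>
     X = V \<and> (\<forall>x\<in>X. \<forall>y\<in>X. d x y = label_dist V E l x y)"

definition US_space :: "'a set \<Rightarrow> ('a \<Rightarrow> 'a \<Rightarrow> real) \<Rightarrow> bool" where
  "US_space X d \<longleftrightarrow> ultrametric_on X d \<and>
     (\<exists>V E c l. star_graph V E c \<and> generated_by X d V E l)"


section \<open>The two four-point spaces\<close>

datatype four_pt = Pa | Pb | Pc | Pe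

lemma UNIV_four_pt: "UNIV = {Pa, Pb, Pc, Pe}"
  using four_pt.exhaust by auto

text \<open>The carrier of both spaces is \<open>UNIV :: four_pt set\<close>.\<close>

definition d4 :: "four_pt \<Rightarrow> four_pt \<Rightarrow> real" where
  "d4 x y = (if x = y then 0
             else if {x, y} = {Pa, Pc} then 1
             else if {x, y} = {Pb, Pe} then 2
             else 3)"

definition rho4 :: "four_pt \<Rightarrow> four_pt \<Rightarrow> real" where
  "rho4 x y = (if x = y then 0
               else if {x, y} = {Pa, Pc} \<or> {x, y} = {Pb, Pe} then 2
               else 3)"

lemma ultrametric_on_d4: "ultrametric_on UNIV d4"
  by (auto simp: ultrametric_on_def semimetric_on_def UNIV_four_pt d4_def doubleton_eq_iff)

lemma ultrametric_on_rho4: "ultrametric_on UNIV rho4"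
  by (auto simp: ultrametric_on_def semimetric_on_def UNIV_four_pt rho4_def doubleton_eq_iff)

end

theory Submission
  imports Defs
begin

text \<open>
  On a labeled star the distance is \<open>d u v = max (l u) (l v)\<close> for \<open>u \<noteq> v\<close>, where without loss
  of generality \<open>l\<close> is least at the center; conversely any such \<open>l\<close> attaining its minimum comes
  from a star. Having a forbidden subspace means that there are \<open>x \<noteq> y\<close> and \<open>z \<noteq> w\<close> with
  \<open>d x y < d x z\<close> and \<open>d z w < d x z\<close>. If there are none, then
  \<open>l x = (INF y\<in>X - {x}. d x y)\<close> is a labeling as above. It attains its minimum: either some
  point is an accumulation point, where \<open>l\<close> vanishes, or \<open>X\<close> is discrete and compact, hence
  finite.
\<close>

section \<open>Labeled stars and the distances they generate\<close>

definition star_edges :: "'a set \<Rightarrow> 'a \<Rightarrow> 'a set set" where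
  "star_edges V c = {{c, v} | v. v \<in> V - {c}}"

lemma mem_star_edges:
  assumes "u \<in> V" "v \<in> V" "c \<in> V"
  shows "{u, v} \<in> star_edges V c \<longleftrightarrow> u \<noteq> v \<and> (u = c \<or> v = c)"
  using assms by (auto simp: star_edges_def doubleton_eq_iff)

lemma star_graph_edges:
  assumes "star_graph V E c" "u \<in> V" "v \<in> V"
  shows "{u, v} \<in> E \<longleftrightarrow> u \<noteq> v \<and> (u = c \<or> v = c)"
proof -
  have "{u, v} \<notin> E" if "u = v"
    using assms(1) that
    by (auto simp: star_graph_def tree_def simple_graph_def doubleton_eq_iff)
  then show ?thesis
    using assms by (auto simp: star_graph_def insert_commute)
qed

definition star_path :: "'a \<Rightarrow> 'a \<Rightarrow> 'a \<Rightarrow> 'a list" where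
  "star_path c u v = (if u = c \<or> v = c then [u, v] else [u, c, v])"

text \<open>Every edge contains \<open>c\<close>. A path with at least four vertices would have
  disjoint first and third edges, both containing \<open>c\<close>, which is impossible; the shorter
  lists are checked directly. The hypothesis speaks of the edges only, so that the lemma also serves
  to prove that \<open>star_edges\<close> yields a tree.\<close>

lemma path_joining_star_iff:
  assumes E: "\<And>u v. u \<in> V \<Longrightarrow> v \<in> V \<Longrightarrow> {u, v} \<in> E \<longleftrightarrow> u \<noteq> v \<and> (u = c \<or> v = c)"
    and "c \<in> V" "u \<in> V" "v \<in> V" "u \<noteq> v"
  shows "path_joining V E u v p \<longleftrightarrow> p = star_path c u v"
proof
  assume "p = star_path c u v"
  then show "path_joining V E u v p"
    using assms by (auto simp: path_joining_def star_path_def)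
next
  assume p: "path_joining V E u v p"
  show "p = star_path c u v"
  proof (cases p rule: remdups_adj.cases)
    case (3 x y q)
    show ?thesis
    proof (cases q rule: remdups_adj.cases)
      case 1
      then show ?thesis using p 3 E by (auto simp: path_joining_def star_path_def)
    next
      case (2 z)
      then show ?thesis using p 3 E by (auto simp: path_joining_def star_path_def)
    next
      case (3 z w r)
      then show ?thesis using p \<open>p = x # y # q\<close> E by (auto simp: path_joining_def)
    qed
  qed (use p assms in \<open>auto simp: path_joining_def\<close>)
qed

text \<open>The joining path always meets the center, so \<open>l c\<close> enters every distance
  between distinct points, also when \<open>u\<close> or \<open>v\<close> is itself the
  center.\<close>

lemma label_dist_star:
  assumes "star_graph V E c" "u \<in> V" "v \<in> V" "u \<noteq> v"
  shows "label_dist V E l u v = max (l c) (max (l u) (l v))"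
proof -
  have "c \<in> V"
    using assms(1) by (simp add: star_graph_def)
  then have "(THE p. path_joining V E u v p) = star_path c u v"
    using path_joining_star_iff[OF star_graph_edges[OF assms(1)]] assms(2-4) by simp
  then show ?thesis
    using assms(4) by (auto simp: label_dist_def star_path_def max.commute max.left_commute)
qed

lemma star_graph_star_edges:
  assumes "c \<in> V"
  shows "star_graph V (star_edges V c) c"
proof -
  let ?E = "star_edges V c"
  note E = mem_star_edges[OF _ _ assms]
  have "\<exists>p. path_joining V ?E u v p" if "u \<in> V" "v \<in> V" for u v
  proof (cases "u = v")
    case True
    then have "path_joining V ?E u v [u]"
      using that by (simp add: path_joining_def)
    then show ?thesis ..
  next
    case False
    then show ?thesis
      using path_joining_star_iff[OF E] assms that by blast
  qed
  then have "connected_graph V ?E"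
    by (simp add: connected_graph_def)
  moreover have "simple_graph V ?E"
    using assms by (auto simp: simple_graph_def star_edges_def)
  moreover have "\<not> graph_cycle V ?E p" for p
  proof
    assume p: "graph_cycle V ?E p"
    then have *: "path_joining V ?E (hd p) (last p) p" "{last p, hd p} \<in> ?E" "length p \<ge> 3"
      by (simp_all add: graph_cycle_def)
    \<comment> \<open>The closing edge of a cycle contains the center, so one end of
      \<open>p\<close> is \<open>c\<close>. By uniqueness of paths \<open>p\<close> is then that
      edge alone, with two vertices instead of at least three.\<close>
    then have V: "hd p \<in> V" "last p \<in> V"
      by (auto simp: path_joining_def)
    then have ends: "hd p \<noteq> last p" "hd p = c \<or> last p = c"
      using *(2) E[OF V(2) V(1)] by auto
    have "p = star_path c (hd p) (last p)"
      using path_joining_star_iff[OF E assms V ends(1)] *(1) by simp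
    then have "length p = 2"
      using ends(2) by (metis star_path_def length_Cons list.size(3) numeral_2_eq_2)
    then show False
      using * by simp
  qed
  ultimately have "tree V ?E"
    using assms by (auto simp: tree_def)
  then show ?thesis
    using assms by (auto simp: star_graph_def E)
qed

lemma US_space_iff_labeling:
  assumes "ultrametric_on X d"
  shows "US_space X d \<longleftrightarrow>
    (\<exists>c\<in>X. \<exists>l. 0 \<le> l c \<and> (\<forall>x\<in>X. l c \<le> l x) \<and>
      (\<forall>x\<in>X. \<forall>y\<in>X. x \<noteq> y \<longrightarrow> d x y = max (l x) (l y)))"
    (is "_ \<longleftrightarrow> (\<exists>c\<in>X. \<exists>l. ?P c l)")
proof
  assume "US_space X d"
  then obtain V E c l where "star_graph V E c" "generated_by X d V E l"
    unfolding US_space_def by blast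
  then have star: "star_graph X E c" and gen: "generated_by X d X E l"
    by (simp_all add: generated_by_def)
  have c: "c \<in> X" "0 \<le> l c"
    using star gen by (auto simp: star_graph_def generated_by_def labeled_tree_def)
  have "d x y = max (max (l c) (l x)) (max (l c) (l y))" if "x \<in> X" "y \<in> X" "x \<noteq> y" for x y
    using gen label_dist_star[OF star that] that
    by (simp add: generated_by_def max.commute max.left_commute)
  \<comment> \<open>Raising every label to at least \<open>l c\<close> changes no distance and makes
    the label least at the center.\<close>
  then have "?P c (\<lambda>x. max (l c) (l x))"
    using c by simp
  then show "\<exists>c\<in>X. \<exists>l. ?P c l"
    using c(1) by (intro bexI exI)
next
  assume "\<exists>c\<in>X. \<exists>l. ?P c l"
  then obtain c l where c: "c \<in> X" and l: "?P c l"
    by (elim bexE exE)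
  note star = star_graph_star_edges[OF c]
  have "d x y = label_dist X (star_edges X c) l x y" if "x \<in> X" "y \<in> X" for x y
  proof (cases "x = y")
    case True
    then show ?thesis
      using assms that by (simp add: label_dist_def ultrametric_on_def semimetric_on_def)
  next
    case False
    then show ?thesis
      using l label_dist_star[OF star that] that by (simp add: max_def)
  qed
  then have "generated_by X d X (star_edges X c) l"
    using star l by (auto simp: generated_by_def labeled_tree_def star_graph_def)
  then show "US_space X d"
    using star assms by (auto simp: US_space_def)
qed

section \<open>Weak similarity and the forbidden four-point subspaces\<close>

text \<open>The bijection runs from the model \<open>Y\<close> to \<open>S\<close>, opposite to the
  definition, so that distances can be compared by cases on the points of \<open>Y\<close>. That
  \<open>f\<close> maps onto \<open>dist_set S d\<close> follows from the distance equation.\<close>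

lemma weakly_similarI:
  assumes \<psi>: "bij_betw \<psi> Y S" and f: "strict_mono_on (dist_set Y \<rho>) f"
    and d: "\<And>a b. a \<in> Y \<Longrightarrow> b \<in> Y \<Longrightarrow> d (\<psi> a) (\<psi> b) = f (\<rho> a b)"
  shows "weakly_similar S d Y \<rho>"
proof -
  have S: "S = \<psi> ` Y"
    using \<psi> by (simp add: bij_betw_def)
  have inv: "inv_into Y \<psi> (\<psi> a) = a" if "a \<in> Y" for a
    using \<psi> that by (simp add: bij_betw_def)
  have "dist_set S d = (\<lambda>(a, b). d (\<psi> a) (\<psi> b)) ` (Y \<times> Y)"
    by (auto simp: dist_set_def S)
  also have "\<dots> = (\<lambda>(a, b). f (\<rho> a b)) ` (Y \<times> Y)"
    by (intro image_cong) (auto simp: d)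
  also have "\<dots> = f ` dist_set Y \<rho>"
    by (auto simp: dist_set_def)
  finally have "f ` dist_set Y \<rho> = dist_set S d" ..
  then have "bij_betw f (dist_set Y \<rho>) (dist_set S d)"
    using f by (auto simp: bij_betw_def intro: strict_mono_on_imp_inj_on)
  moreover have "bij_betw (inv_into Y \<psi>) S Y"
    using \<psi> by (rule bij_betw_inv_into)
  moreover have "d x y = f (\<rho> (inv_into Y \<psi> x) (inv_into Y \<psi> y))" if "x \<in> S" "y \<in> S" for x y
    using that d unfolding S by (auto simp: inv)
  ultimately show ?thesis
    using f unfolding weakly_similar_def by blast
qed

text \<open>Strict monotonicity of \<open>f\<close> carries strict inequalities between distances in
  the model over to \<open>S\<close>; these are all that is read off from a forbidden
  subspace.\<close>

lemma weakly_similar_lessE: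
  assumes "weakly_similar S d Y \<rho>"
  obtains \<psi> where "bij_betw \<psi> Y S"
    "\<And>a b a' b'. {a, b, a', b'} \<subseteq> Y \<Longrightarrow> \<rho> a b < \<rho> a' b' \<Longrightarrow> d (\<psi> a) (\<psi> b) < d (\<psi> a') (\<psi> b')"
proof -
  obtain \<Phi> f where \<Phi>: "bij_betw \<Phi> S Y" and f: "strict_mono_on (dist_set Y \<rho>) f"
    and d: "\<And>x y. x \<in> S \<Longrightarrow> y \<in> S \<Longrightarrow> d x y = f (\<rho> (\<Phi> x) (\<Phi> y))"
    using assms unfolding weakly_similar_def by blast
  let ?\<psi> = "inv_into S \<Phi>"
  have \<psi>: "bij_betw ?\<psi> Y S"
    using \<Phi> by (rule bij_betw_inv_into)
  have "d (?\<psi> a) (?\<psi> b) = f (\<rho> a b)" if "a \<in> Y" "b \<in> Y" for a b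
    using d bij_betwE[OF \<psi>] bij_betw_inv_into_right[OF \<Phi>] that by simp
  moreover have "\<rho> a b \<in> dist_set Y \<rho>" if "a \<in> Y" "b \<in> Y" for a b
    using that by (auto simp: dist_set_def)
  ultimately show thesis
    using that[OF \<psi>] f by (simp add: strict_mono_on_def)
qed

text \<open>The pairs \<open>x\<close>, \<open>y\<close> and \<open>z\<close>, \<open>w\<close> are
  closer together than \<open>x\<close> and \<open>z\<close>, so the ultrametric inequality makes
  all four cross distances equal. A strict inequality in \<open>le\<close> gives \<open>d4\<close>,
  equality gives \<open>rho4\<close>.\<close>

lemma four_point_weakly_similar_d4_rho4:
  assumes "ultrametric_on X d" and X: "x \<in> X" "y \<in> X" "z \<in> X" "w \<in> X"
    and neq: "x \<noteq> y" "z \<noteq> w" and le: "d x y \<le> d z w" and less: "d z w < d x z"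
  shows "\<exists>S\<subseteq>X. card S = 4 \<and>
    (weakly_similar S d (UNIV :: four_pt set) d4 \<or> weakly_similar S d (UNIV :: four_pt set) rho4)"
proof -
  have d: "0 \<le> d p q" "d p q = d q p" "d p q = 0 \<longleftrightarrow> p = q"
    if "p \<in> X" "q \<in> X" for p q
    using assms(1) that unfolding ultrametric_on_def semimetric_on_def by blast+
  have ultra: "d p q \<le> max (d p r) (d r q)" if "p \<in> X" "q \<in> X" "r \<in> X" for p q r
    using assms(1) that unfolding ultrametric_on_def by blast
  define m where "m = d x z"
  define S where "S = {x, y, z, w}"
  \<comment> \<open>In constructor order: \<open>Pa\<close>, \<open>Pc\<close> go to
    \<open>x\<close>, \<open>y\<close>, and \<open>Pb\<close>, \<open>Pe\<close> go to
    \<open>z\<close>, \<open>w\<close>.\<close>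
  define \<psi> where "\<psi> = case_four_pt x z y w"
  have pos: "0 < d x y" "0 < d z w"
    using d(1,3)[OF X(1,2)] d(1,3)[OF X(3,4)] neq by simp_all
  have sym: "d y x = d x y" "d w z = d z w" "d z x = d x z" "d w x = d x w" "d z y = d y z"
    "d w y = d y w"
    using d(2) X by auto
  have self: "d x x = 0" "d y y = 0" "d z z = 0" "d w w = 0"
    using d(3) X by auto
  \<comment> \<open>In a triangle with one side shorter than another, the two longer sides are
    equal; here the short side is \<open>d z w\<close>.\<close>
  have "d x w = m"
    using ultra[of x z w] ultra[of x w z] X less sym unfolding m_def by auto
  moreover have yz: "d y z = m"
    using ultra[of y z x] ultra[of x z y] X le less sym unfolding m_def by auto
  moreover have "d y w = m"
    using ultra[of y z w] ultra[of y w z] X less sym yz unfolding m_def by auto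
  ultimately have m: "d x z = m" "d x w = m" "d y z = m" "d y w = m"
    by (simp_all add: m_def)
  then have neqs: "x \<noteq> z" "x \<noteq> w" "y \<noteq> z" "y \<noteq> w"
    using pos le less self m_def by auto
  have \<psi>: "bij_betw \<psi> UNIV S"
    using neq neqs by (auto simp: bij_betw_def inj_on_def UNIV_four_pt S_def \<psi>_def)
  have "S \<subseteq> X" "card S = 4"
    using neq neqs X by (auto simp: S_def)
  moreover have "weakly_similar S d (UNIV :: four_pt set) d4" if "d x y < d z w"
  proof (rule weakly_similarI[OF \<psi>])
    \<comment> \<open>The last branch is the value at 3. Monotonicity is checked on a finite set
      containing the distance set.\<close>
    let ?f = "\<lambda>t::real. if t = 0 then 0 else if t = 1 then d x y else if t = 2 then d z w else m"
    have "dist_set (UNIV :: four_pt set) d4 \<subseteq> {0, 1, 2, 3}"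
      by (auto simp: dist_set_def d4_def)
    moreover have "strict_mono_on {0, 1, 2, 3} ?f"
      using pos that less m_def by (auto simp: strict_mono_on_def)
    ultimately show "strict_mono_on (dist_set (UNIV :: four_pt set) d4) ?f"
      by (rule monotone_on_subset[rotated])
    show "d (\<psi> a) (\<psi> b) = ?f (d4 a b)" for a b
      by (cases a; cases b) (simp_all add: \<psi>_def d4_def doubleton_eq_iff sym self m)
  qed
  moreover have "weakly_similar S d (UNIV :: four_pt set) rho4" if "d x y = d z w"
  proof (rule weakly_similarI[OF \<psi>])
    let ?f = "\<lambda>t::real. if t = 0 then 0 else if t = 2 then d z w else m"
    have "dist_set (UNIV :: four_pt set) rho4 \<subseteq> {0, 2, 3}"
      by (auto simp: dist_set_def rho4_def)
    moreover have "strict_mono_on {0, 2, 3} ?f"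
      using pos less m_def by (auto simp: strict_mono_on_def)
    ultimately show "strict_mono_on (dist_set (UNIV :: four_pt set) rho4) ?f"
      by (rule monotone_on_subset[rotated])
    show "d (\<psi> a) (\<psi> b) = ?f (rho4 a b)" for a b
      by (cases a; cases b) (simp_all add: \<psi>_def rho4_def doubleton_eq_iff sym self m that)
  qed
  ultimately show ?thesis
    using le by (meson order_le_less)
qed

lemma four_point_subspace_iff:
  assumes "ultrametric_on X d"
  shows "(\<exists>S\<subseteq>X. card S = 4 \<and>
      (weakly_similar S d (UNIV :: four_pt set) d4 \<or>
       weakly_similar S d (UNIV :: four_pt set) rho4)) \<longleftrightarrow>
    (\<exists>x\<in>X. \<exists>y\<in>X. \<exists>z\<in>X. \<exists>w\<in>X. x \<noteq> y \<and> z \<noteq> w \<and> d x y < d x z \<and> d z w < d x z)"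
    (is "?L \<longleftrightarrow> ?R")
proof
  assume ?L
  then obtain S and \<rho> :: "four_pt \<Rightarrow> four_pt \<Rightarrow> real" where S: "S \<subseteq> X"
    and sim: "weakly_similar S d UNIV \<rho>" and \<rho>: "\<rho> = d4 \<or> \<rho> = rho4"
    by blast
  obtain \<psi> :: "four_pt \<Rightarrow> 'a" where \<psi>: "bij_betw \<psi> UNIV S"
    and less: "\<And>a b a' b'. \<rho> a b < \<rho> a' b' \<Longrightarrow> d (\<psi> a) (\<psi> b) < d (\<psi> a') (\<psi> b')"
    using weakly_similar_lessE[OF sim] by (metis subset_UNIV)
  have "\<rho> Pa Pc < \<rho> Pa Pb" "\<rho> Pb Pe < \<rho> Pa Pb"
    using \<rho> by (auto simp: d4_def rho4_def doubleton_eq_iff)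
  then have "d (\<psi> Pa) (\<psi> Pc) < d (\<psi> Pa) (\<psi> Pb)" "d (\<psi> Pb) (\<psi> Pe) < d (\<psi> Pa) (\<psi> Pb)"
    by (auto intro: less)
  moreover have "\<psi> Pa \<noteq> \<psi> Pc" "\<psi> Pb \<noteq> \<psi> Pe"
    using \<psi> by (auto simp: bij_betw_def dest: injD)
  moreover have "\<psi> a \<in> X" for a
    using \<psi> S by (auto simp: bij_betw_def)
  ultimately show ?R
    by blast
next
  assume ?R
  then obtain x y z w where *: "x \<in> X" "y \<in> X" "z \<in> X" "w \<in> X" "x \<noteq> y" "z \<noteq> w"
    "d x y < d x z" "d z w < d x z"
    by blast
  then have "d x y < d z x"
    using assms by (auto simp: ultrametric_on_def semimetric_on_def)
  show ?L
  \<comment> \<open>The configuration is symmetric under exchanging the two pairs, so the closer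
    pair may be put first.\<close>
  proof (cases "d x y \<le> d z w")
    case True
    then show ?L
      using * by (intro four_point_weakly_similar_d4_rho4[OF assms, of x y z w])
  next
    case False
    then have "d z w \<le> d x y"
      by simp
    then show ?L
      using * \<open>d x y < d z x\<close> by (intro four_point_weakly_similar_d4_rho4[OF assms, of z w x y])
  qed
qed

section \<open>Compactness and the construction of the labeling\<close>

lemma compact_on_discrete_finite:
  assumes "ultrametric_on X d" "compact_on X d"
    and iso: "\<And>x. x \<in> X \<Longrightarrow> \<exists>r>0. \<forall>y\<in>X. d x y < r \<longrightarrow> y = x"
  shows "finite X"
proof -
  interpret Metric_space X "zero_ext X d"
    by (rule Metric_space_zero_ext[OF assms(1)])
  have "openin mtopology {x}" if "x \<in> X" for x
    using iso[OF that] that by (simp add: openin_mtopology_zero_ext[OF assms(1)])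
  then have "mtopology = discrete_topology X"
    by (metis discrete_topology_unique topspace_mtopology)
  then show ?thesis
    using assms(2) by (simp add: compact_on_def compact_space_discrete_topology)
qed

theorem theorem5p2:
  fixes X :: "'a set" and d :: "'a \<Rightarrow> 'a \<Rightarrow> real"
  assumes "ultrametric_on X d"
    and "compact_on X d"
  shows "US_space X d \<longleftrightarrow>
    \<not> (\<exists>S\<subseteq>X. card S = 4 \<and>
          (weakly_similar S d (UNIV :: four_pt set) d4 \<or>
           weakly_similar S d (UNIV :: four_pt set) rho4))"
  unfolding four_point_subspace_iff[OF assms(1)] US_space_iff_labeling[OF assms(1)]
proof (intro iffI notI)
  assume "\<exists>c\<in>X. \<exists>l. 0 \<le> l c \<and> (\<forall>x\<in>X. l c \<le> l x) \<and>
      (\<forall>x\<in>X. \<forall>y\<in>X. x \<noteq> y \<longrightarrow> d x y = max (l x) (l y))"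
  then obtain l where l: "\<forall>x\<in>X. \<forall>y\<in>X. x \<noteq> y \<longrightarrow> d x y = max (l x) (l y)"
    by (elim bexE exE conjE)
  assume "\<exists>x\<in>X. \<exists>y\<in>X. \<exists>z\<in>X. \<exists>w\<in>X. x \<noteq> y \<and> z \<noteq> w \<and> d x y < d x z \<and> d z w < d x z"
  then obtain x y z w where *: "x \<in> X" "y \<in> X" "z \<in> X" "w \<in> X" "x \<noteq> y" "z \<noteq> w"
    "d x y < d x z" "d z w < d x z"
    by blast
  have "0 \<le> d x y" "d x x = 0"
    using assms(1) * by (auto simp: ultrametric_on_def semimetric_on_def)
  \<comment> \<open>Distinctness is what allows the formula for \<open>l\<close> to be applied to
    \<open>d x z\<close>: both labels are bounded by the smaller distances \<open>d x y\<close> and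
    \<open>d z w\<close>.\<close>
  then have "x \<noteq> z"
    using * by auto
  then show False
    using l[rule_format, of x y] l[rule_format, of z w] l[rule_format, of x z] * by auto
next
  assume "\<not> (\<exists>x\<in>X. \<exists>y\<in>X. \<exists>z\<in>X. \<exists>w\<in>X. x \<noteq> y \<and> z \<noteq> w \<and> d x y < d x z \<and> d z w < d x z)"
  then have no: "\<forall>x\<in>X. \<forall>y\<in>X. \<forall>z\<in>X. \<forall>w\<in>X.
      x \<noteq> y \<longrightarrow> z \<noteq> w \<longrightarrow> d x y < d x z \<longrightarrow> \<not> d z w < d x z"
    by auto
  have nonneg: "0 \<le> d x y" and sym: "d x y = d y x" if "x \<in> X" "y \<in> X" for x y
    using assms(1) that by (auto simp: ultrametric_on_def semimetric_on_def)
  obtain x0 where x0: "x0 \<in> X"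
    using assms(1) by (auto simp: ultrametric_on_def semimetric_on_def)
  show "\<exists>c\<in>X. \<exists>l. 0 \<le> l c \<and> (\<forall>x\<in>X. l c \<le> l x) \<and>
      (\<forall>x\<in>X. \<forall>y\<in>X. x \<noteq> y \<longrightarrow> d x y = max (l x) (l y))"
  \<comment> \<open>For a single point the infimum defining \<open>l\<close> would range over the
    empty set.\<close>
  proof (cases "X = {x0}")
    case True
    then show ?thesis
      by (intro bexI[of _ x0] exI[of _ "\<lambda>_. 0"]) auto
  next
    case False
    define l where "l x = (INF y\<in>X - {x}. d x y)" for x
    have ne: "X - {x} \<noteq> {}" for x
      using False x0 by auto
    have bdd: "bdd_below (d x ` (X - {x}))" if "x \<in> X" for x
      using nonneg[OF that] by (auto intro: bdd_belowI[of _ 0])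
    have l_le: "l x \<le> d x y" if "x \<in> X" "y \<in> X" "y \<noteq> x" for x y
      unfolding l_def using bdd that by (intro cINF_lower) auto
    have l_nonneg: "0 \<le> l x" if "x \<in> X" for x
      unfolding l_def using ne nonneg that by (intro cINF_greatest) auto
    have l_less: "\<exists>y\<in>X. y \<noteq> x \<and> d x y < t" if "x \<in> X" "l x < t" for x t
      using that cINF_less_iff[OF ne bdd[OF that(1)]] unfolding l_def by auto
    have "d x z = max (l x) (l z)" if "x \<in> X" "z \<in> X" "x \<noteq> z" for x z
    proof (rule antisym)
      show "max (l x) (l z) \<le> d x z"
        using l_le[of x z] l_le[of z x] sym[of x z] that by simp
      show "d x z \<le> max (l x) (l z)"
      proof (rule ccontr)
        assume "\<not> d x z \<le> max (l x) (l z)"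
        then have "l x < d x z" "l z < d x z"
          by auto
        \<comment> \<open>Labels below \<open>d x z\<close> are infima, so points \<open>y\<close>
          near \<open>x\<close> and \<open>w\<close> near \<open>z\<close> realize the excluded
          configuration.\<close>
        then obtain y w where "y \<in> X" "y \<noteq> x" "d x y < d x z" "w \<in> X" "w \<noteq> z" "d z w < d x z"
          using l_less \<open>x \<in> X\<close> \<open>z \<in> X\<close> by metis
        then show False
          using no[rule_format, of x y z w] that by simp
      qed
    qed
    moreover obtain c where "c \<in> X" "\<forall>x\<in>X. l c \<le> l x"
    proof (cases "\<exists>c\<in>X. l c = 0")
      case True
      then show ?thesis
        using that l_nonneg by force
    next
      case False
      have "\<exists>r>0. \<forall>y\<in>X. d x y < r \<longrightarrow> y = x" if x: "x \<in> X" for x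
      \<comment> \<open>No other point is closer to \<open>x\<close> than \<open>l x\<close>, so a
        positive label is itself an isolation radius.\<close>
      proof (intro exI[of _ "l x"] conjI ballI impI)
        show "0 < l x"
          using False l_nonneg[OF x] x by (metis less_eq_real_def)
        show "y = x" if "y \<in> X" "d x y < l x" for y
          using l_le[OF x] that by force
      qed
      then have "finite X"
        by (rule compact_on_discrete_finite[OF assms])
      then show ?thesis
        using that[of "arg_min_on l X"] x0 arg_min_least[of X _ l] arg_min_if_finite(1)[of X l] by auto
    qed
    ultimately show ?thesis
      using l_nonneg by (intro bexI[of _ c] exI[of _ l]) auto
  qed
qed

end
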